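(* Let $n$ and $t$ be positive integers and let $P\subseteq[0,1]^n$ be the $n$-dimensional cropped cube. Then the $t$-branch split rank of $P$ is at least $\lceil\frac{n}{t}\rceil$.
   Context: The $n$-dimensional cropped cube is the polytope in $\mathbb{R}^n$ defined by the constraints $\sum_{i\in J}x_i+\sum_{i\notin J}(1-x_i)\ge\frac12$ for all $J\subseteq\{1,\dots,n\}$, and $0\le x_i\le1$ for all $i\in\{1,\dots,n\}$. For $P\subseteq\mathbb{R}^n$, the $t$-branch split closure of $P$ is $$tSC(P)=\bigcap_{\pi^1,\dots,\pi^t\in\mathbb{Z}^n,\ \pi^1_0,\dots,\pi^t_0\in\mathbb{Z}}\mathrm{conv}\Big(\bigcap_{j=1}^t\big(\{x\in P:\pi^jx\le\pi^j_0\}\cup\{x\in P:\pi^jx\ge\pi^j_0+1\}\big)\Big),$$ where $\pi x$ denotes the inner product of $\pi$ and $x$. Put $tSC^0(P)=P$ and $tSC^k(P)=tSC(tSC^{k-1}(P))$ for $k\ge1$. Let $P_I$ denote the convex hull of the integral points of $P$. The $t$-branch split rank of $P$ is the minimum $k\ge0$ such that $tSC^k(P)=P_I$. *)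

theory Defs
  imports "HOL-Analysis.Analysis" "HOL-Library.Extended_Nat"
begin

definition cropped_cube :: "(real ^ 'n::finite) set" where
  "cropped_cube =
    {x. (\<forall>J. (\<Sum>i\<in>J. x $ i) + (\<Sum>i\<in>-J. 1 - x $ i) \<ge> 1 / 2) \<and>
        (\<forall>i. 0 \<le> x $ i \<and> x $ i \<le> 1)}"

definition integral_points :: "(real ^ 'n::finite) set" where
  "integral_points = {x. \<forall>i. x $ i \<in> \<int>}"

definition integer_hull :: "(real ^ 'n::finite) set \<Rightarrow> (real ^ 'n) set" where
  "integer_hull P = convex hull (P \<inter> integral_points)"

(* Only meaningful for t >= 1. The functions in the two families are unconstrained
   outside {1..t}, where their values are not used. *)
definition split_closure :: "nat \<Rightarrow> (real ^ 'n::finite) set \<Rightarrow> (real ^ 'n) set" where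
  "split_closure t P =
    (\<Inter>\<pi> \<in> {1..t} \<rightarrow> integral_points. \<Inter>\<pi>\<^sub>0 \<in> {1..t} \<rightarrow> \<int>.
      convex hull
        (\<Inter>j\<in>{1..t}. {x \<in> P. \<pi> j \<bullet> x \<le> \<pi>\<^sub>0 j} \<union> {x \<in> P. \<pi> j \<bullet> x \<ge> \<pi>\<^sub>0 j + 1}))"

(* Valued in enat: the rank is infinite if no iterate equals the integer hull. *)
definition split_rank :: "nat \<Rightarrow> (real ^ 'n::finite) set \<Rightarrow> enat" where
  "split_rank t P = Inf {enat k | k. (split_closure t ^^ k) P = integer_hull P}"

end

theory Submission imports Defs begin

text \<open>
  The integer hull of the cropped cube is empty, because the constraint for the set of zeros of a
  0/1 vector cuts that vector off. So the rank is at least every \<open>k\<close> for which all earlier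
  iterates are nonempty, and it suffices to see that a closure step does not remove too much.

  What survives is controlled by the vectors with entries in \<open>{0, 1/2, 1}\<close>. The cropped cube
  contains all of them that have at least one entry \<open>1/2\<close>. If a set contains all of them with
  at least \<open>m\<close> entries \<open>1/2\<close>, then its \<open>t\<close>-branch split closure contains all of them with at
  least \<open>m + t\<close> (lemma \<open>half_vectors_split_closure\<close>): given such an \<open>x\<close> and \<open>t\<close> integral
  vectors, one finds at most \<open>t\<close> half entries of \<open>x\<close> such that rounding all of them up, or all
  of them down, makes every one of the \<open>t\<close> inner products an integer. An integer lies in no open
  strip between \<open>c\<close> and \<open>c + 1\<close>, so both rounded points satisfy all the disjunctions, and
  \<open>x\<close> is their midpoint.

  Integrality of the inner products is a system of \<open>t\<close> parity conditions on the set of rounded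
  entries. Rounding every half entry solves it, and over the field with two elements a solvable
  system of \<open>t\<close> equations has a solution of support at most \<open>t\<close>
  (lemma \<open>small_set_even_complement\<close>).

  Hence the \<open>k\<close>-th iterate contains the centre of the cube as long as \<open>k * t + 1 \<le> n\<close>.
\<close>

text \<open>
  Pigeonhole form of linear dependence over the field with two elements: two distinct subsets
  of \<open>S\<close> have the same parities, and their symmetric difference is the desired set.
\<close>
lemma even_intersections_exists:
  assumes "finite S" and "finite T" and "card T < card S"
  obtains D where "D \<subseteq> S" and "D \<noteq> {}" and "\<And>j. j \<in> T \<Longrightarrow> even (card (D \<inter> E j))"
proof -
  define parities where "parities A = {j \<in> T. odd (card (A \<inter> E j))}" for A
  have "\<not> inj_on parities (Pow S)"
  proof
    assume "inj_on parities (Pow S)"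
    moreover have "parities ` Pow S \<subseteq> Pow T"
      by (auto simp: parities_def)
    ultimately have "card (Pow S) \<le> card (Pow T)"
      using assms by (intro card_inj_on_le) auto
    then show False
      using assms by (simp add: card_Pow)
  qed
  then obtain A B where AB: "A \<subseteq> S" "B \<subseteq> S" "A \<noteq> B" "parities A = parities B"
    by (auto simp: inj_on_def)
  then have fin: "finite A" "finite B"
    using assms(1) by (auto intro: finite_subset)
  show thesis
  proof
    show "(A - B) \<union> (B - A) \<subseteq> S" "(A - B) \<union> (B - A) \<noteq> {}"
      using AB by auto
  next
    fix j assume "j \<in> T"
    then have same: "odd (card (A \<inter> E j)) \<longleftrightarrow> odd (card (B \<inter> E j))"
      using AB(4) by (auto simp: parities_def set_eq_iff)
    have "card (A \<inter> E j) = card ((A - B) \<inter> E j) + card (A \<inter> B \<inter> E j)"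
      using fin by (subst card_Un_disjoint[symmetric]) (auto intro: arg_cong[where f = card])
    moreover have "card (B \<inter> E j) = card ((B - A) \<inter> E j) + card (A \<inter> B \<inter> E j)"
      using fin by (subst card_Un_disjoint[symmetric]) (auto intro: arg_cong[where f = card])
    moreover have "card (((A - B) \<union> (B - A)) \<inter> E j) = card ((A - B) \<inter> E j) + card ((B - A) \<inter> E j)"
      using fin by (subst card_Un_disjoint[symmetric]) (auto intro: arg_cong[where f = card])
    ultimately show "even (card (((A - B) \<union> (B - A)) \<inter> E j))"
      using same by presburger
  qed
qed

text \<open>
  A solvable parity system has a solution no larger than its number of equations: as long as the
  set is too large, a nonempty solution of the homogeneous system can be removed from it.
\<close>
lemma small_set_even_complement:
  assumes "finite S" and "finite T"
  shows "\<exists>I\<subseteq>S. card I \<le> card T \<and> (\<forall>j\<in>T. even (card ((S - I) \<inter> E j)))"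
  using assms(1)
proof (induction S rule: finite_psubset_induct)
  case (psubset S)
  show ?case
  proof (cases "card S \<le> card T")
    case True
    then show ?thesis by (intro exI[of _ S]) auto
  next
    case False
    then obtain D where D: "D \<subseteq> S" "D \<noteq> {}" "\<And>j. j \<in> T \<Longrightarrow> even (card (D \<inter> E j))"
      using even_intersections_exists[of S T E] psubset.hyps assms(2) by auto
    then obtain I where I: "I \<subseteq> S - D" "card I \<le> card T"
      "\<forall>j\<in>T. even (card ((S - D - I) \<inter> E j))"
      using psubset.IH[of "S - D"] by blast
    have "even (card ((S - I) \<inter> E j))" if "j \<in> T" for j
    proof -
      have "(S - I) \<inter> E j = ((S - D - I) \<inter> E j) \<union> (D \<inter> E j)"
        using D(1) I(1) by auto
      moreover have "card \<dots> = card ((S - D - I) \<inter> E j) + card (D \<inter> E j)"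
        using psubset.hyps D(1) finite_subset by (intro card_Un_disjoint) auto
      ultimately show ?thesis using D(3) I(3) that by simp
    qed
    then show ?thesis using I by (intro exI[of _ I]) auto
  qed
qed

definition half_vectors :: "nat \<Rightarrow> (real ^ 'n::finite) set" where
  "half_vectors m = {x. (\<forall>i. x $ i \<in> {0, 1/2, 1}) \<and> m \<le> card {i. x $ i = 1/2}}"

text \<open>The half entries contribute half the sum of their integer coefficients.\<close>
lemma inner_half_vector_Ints:
  fixes x :: "real ^ 'n::finite" and q :: "'n \<Rightarrow> int"
  assumes x: "\<And>i. x $ i \<in> {0, 1/2, 1}"
    and p: "\<And>i. p $ i = of_int (q i)"
    and ev: "even (card ({i. x $ i = 1/2} \<inter> {i. odd (q i)}))"
  shows "p \<bullet> x \<in> \<int>"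
proof -
  let ?H = "{i. x $ i = 1/2}"
  have "even (sum q ?H)"
    using ev by (simp add: even_sum_iff Int_def)
  then obtain m where m: "sum q ?H = 2 * m" by blast
  have "p \<bullet> x = (\<Sum>i\<in>?H. p $ i * x $ i) + (\<Sum>i\<in>-?H. p $ i * x $ i)"
    by (simp add: inner_vec_def sum.subset_diff[of ?H UNIV] Compl_eq_Diff_UNIV)
  also have "(\<Sum>i\<in>?H. p $ i * x $ i) = of_int (sum q ?H) / 2"
    unfolding of_int_sum sum_divide_distrib by (intro sum.cong) (auto simp: p)
  also have "\<dots> = of_int m"
    unfolding m by simp
  finally have "p \<bullet> x = of_int m + (\<Sum>i\<in>-?H. p $ i * x $ i)" .
  moreover have "p $ i * x $ i \<in> \<int>" if "i \<in> -?H" for i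
    using x[of i] that by (auto simp: p)
  ultimately show ?thesis
    by (metis (no_types, lifting) Ints_add Ints_of_int Ints_sum)
qed

lemma Ints_outside_unit_gap:
  fixes a c :: real
  assumes "a \<in> \<int>" and "c \<in> \<int>"
  shows "a \<le> c \<or> c + 1 \<le> a"
  using assms by (auto elim!: Ints_cases)

text \<open>
  Each of the \<open>t\<close> directions costs at most one half entry, so both rounded points lie in \<open>Q\<close>.
\<close>
lemma half_vectors_split_closure:
  fixes Q :: "(real ^ 'n::finite) set"
  assumes Q: "half_vectors m \<subseteq> Q"
  shows "half_vectors (m + t) \<subseteq> split_closure t Q"
proof
  fix x :: "real ^ 'n"
  assume x: "x \<in> half_vectors (m + t)"
  show "x \<in> split_closure t Q"
    unfolding split_closure_def
  proof (intro INT_I)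
    fix p :: "nat \<Rightarrow> real ^ 'n" and c :: "nat \<Rightarrow> real"
    assume p: "p \<in> {1..t} \<rightarrow> integral_points" and c: "c \<in> {1..t} \<rightarrow> \<int>"
    let ?D = "\<Inter>j\<in>{1..t}. {x \<in> Q. p j \<bullet> x \<le> c j} \<union> {x \<in> Q. p j \<bullet> x \<ge> c j + 1}"
    define q where "q j i = \<lfloor>p j $ i\<rfloor>" for j i
    have pq: "p j $ i = of_int (q j i)" if "j \<in> {1..t}" for j i
      using p that by (auto simp: q_def integral_points_def Pi_iff)
    define H where "H = {i. x $ i = 1/2}"
    obtain I where I: "I \<subseteq> H" "card I \<le> t"
      "\<And>j. j \<in> {1..t} \<Longrightarrow> even (card ((H - I) \<inter> {i. odd (q j i)}))"
      using small_set_even_complement[of H "{1..t}" "\<lambda>j. {i. odd (q j i)}"] by auto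
    define rounded where "rounded b = (\<chi> i. if i \<in> I then b else x $ i)" for b
    have "rounded b \<in> ?D" if b: "b \<in> {0, 1}" for b
    proof -
      have entries: "rounded b $ i \<in> {0, 1/2, 1}" for i
        using x b by (auto simp: rounded_def half_vectors_def)
      have halves: "{i. rounded b $ i = 1/2} = H - I"
        using b by (auto simp: rounded_def H_def)
      have "m + t \<le> card H"
        using x by (simp add: half_vectors_def H_def)
      then have "m \<le> card (H - I)"
        using I(1,2) by (simp add: card_Diff_subset)
      then have "rounded b \<in> Q"
        using entries halves by (intro subsetD[OF Q]) (simp add: half_vectors_def)
      moreover have "p j \<bullet> rounded b \<in> \<int>" if "j \<in> {1..t}" for j
        using inner_half_vector_Ints[of "rounded b" "p j" "q j"] entries pq[OF that] I(3)[OF that]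
        unfolding halves by blast
      then have "p j \<bullet> rounded b \<le> c j \<or> c j + 1 \<le> p j \<bullet> rounded b" if "j \<in> {1..t}" for j
        using c that by (intro Ints_outside_unit_gap) auto
      ultimately show ?thesis by blast
    qed
    then have "rounded 0 \<in> ?D" "rounded 1 \<in> ?D" by simp_all
    moreover have "x = (1/2) *\<^sub>R rounded 0 + (1/2) *\<^sub>R rounded 1"
      using I(1) by (auto simp: vec_eq_iff rounded_def H_def)
    ultimately show "x \<in> convex hull ?D"
      using convexD[OF convex_convex_hull, of "rounded 0" ?D "rounded 1" "1/2" "1/2"]
      by (simp add: hull_inc)
  qed
qed

lemma half_vectors_split_closure_power:
  fixes Q :: "(real ^ 'n::finite) set"
  assumes "half_vectors m \<subseteq> Q"
  shows "half_vectors (m + k * t) \<subseteq> (split_closure t ^^ k) Q"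
proof (induction k)
  case 0
  then show ?case using assms by simp
next
  case (Suc k)
  from half_vectors_split_closure[OF this, of t] show ?case
    by (simp add: add_ac)
qed

text \<open>In each of the defining constraints a half entry alone contributes \<open>1/2\<close>.\<close>
lemma half_vectors_cropped_cube: "half_vectors 1 \<subseteq> (cropped_cube :: (real ^ 'n::finite) set)"
proof
  fix x :: "real ^ 'n"
  assume x: "x \<in> half_vectors 1"
  then have "card {i. x $ i = 1/2} \<noteq> 0"
    unfolding half_vectors_def by (metis (mono_tags) mem_Collect_eq not_one_le_zero)
  then obtain h where h: "x $ h = 1/2"
    by (metis (mono_tags, lifting) card.empty empty_Collect_eq)
  have bounds: "0 \<le> x $ i" "x $ i \<le> 1" for i
  proof -
    have "x $ i \<in> {0, 1/2, 1}"
      using x by (simp add: half_vectors_def)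
    then show "0 \<le> x $ i" "x $ i \<le> 1" by auto
  qed
  have "1/2 \<le> (\<Sum>i\<in>J. x $ i) + (\<Sum>i\<in>-J. 1 - x $ i)" for J
  proof (cases "h \<in> J")
    case True
    then have "x $ h \<le> (\<Sum>i\<in>J. x $ i)"
      using bounds by (intro member_le_sum) auto
    moreover have "0 \<le> (\<Sum>i\<in>-J. 1 - x $ i)"
      using bounds by (intro sum_nonneg) auto
    ultimately show ?thesis using h by simp
  next
    case False
    then have "1 - x $ h \<le> (\<Sum>i\<in>-J. 1 - x $ i)"
      using bounds by (intro member_le_sum) auto
    moreover have "0 \<le> (\<Sum>i\<in>J. x $ i)"
      using bounds by (intro sum_nonneg) auto
    ultimately show ?thesis using h by simp
  qed
  then show "x \<in> cropped_cube"
    using bounds by (simp add: cropped_cube_def)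
qed

lemma integer_hull_cropped_cube: "integer_hull (cropped_cube :: (real ^ 'n::finite) set) = {}"
proof -
  have "x \<notin> integral_points" if x: "x \<in> cropped_cube" for x :: "real ^ 'n"
  proof
    assume "x \<in> integral_points"
    then have one: "x $ i = 1" if "x $ i \<noteq> 0" for i
    proof -
      have "x $ i \<in> \<int>" "0 \<le> x $ i" "x $ i \<le> 1"
        using x \<open>x \<in> integral_points\<close> by (auto simp: cropped_cube_def integral_points_def)
      then show ?thesis using that by (auto elim!: Ints_cases)
    qed
    have "1/2 \<le> (\<Sum>i\<in>{i. x $ i = 0}. x $ i) + (\<Sum>i\<in>-{i. x $ i = 0}. 1 - x $ i)"
      using x unfolding cropped_cube_def by blast
    also have "\<dots> = 0"
      using one by (metis (mono_tags, lifting) ComplD add_0 diff_self mem_Collect_eq sum.neutral)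
    finally show False by simp
  qed
  then show ?thesis
    by (auto simp: integer_hull_def disjoint_iff convex_hull_eq_empty)
qed

theorem corollary3:
  fixes t :: nat and P :: "(real ^ 'n::finite) set"
  assumes "t > 0"
    and "P = cropped_cube"
  shows "split_rank t P \<ge> enat (nat \<lceil>real CARD('n) / real t\<rceil>)"
  unfolding split_rank_def
proof (rule Inf_greatest)
  fix r
  assume "r \<in> {enat k | k. (split_closure t ^^ k) P = integer_hull P}"
  then obtain k where k: "r = enat k" "(split_closure t ^^ k) P = {}"
    using assms(2) integer_hull_cropped_cube by auto
  then have empty: "half_vectors (1 + k * t) = ({} :: (real ^ 'n) set)"
    using half_vectors_split_closure_power[OF half_vectors_cropped_cube, of k t] assms(2) by auto
  have "CARD('n) \<le> k * t"
  proof (rule ccontr)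
    assume "\<not> CARD('n) \<le> k * t"
    then have "(\<chi> i. 1/2) \<in> (half_vectors (1 + k * t) :: (real ^ 'n) set)"
      by (simp add: half_vectors_def)
    then show False using empty by blast
  qed
  then have "real CARD('n) \<le> real k * real t"
    by (metis of_nat_le_iff of_nat_mult)
  then have "real CARD('n) / real t \<le> real k"
    using assms(1) by (simp add: divide_le_eq)
  then have "nat \<lceil>real CARD('n) / real t\<rceil> \<le> k"
    by (simp add: ceiling_le_iff nat_le_iff)
  then show "enat (nat \<lceil>real CARD('n) / real t\<rceil>) \<le> r"
    by (simp add: k(1))
qed

end
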